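(* Assume the following. ($A_1$) $X$ is a reflexive Banach space, and $K\subsetneq X$ is non-empty, closed and convex. ($A_2$) $X_\varphi$ is a Banach space and $\gamma_\varphi\in\mathcal{L}(X,X_\varphi)$, with a constant $c_\varphi>0$ such that $\|\gamma_\varphi v\|_{X_\varphi}\le c_\varphi\|v\|_X$ for all $v\in X$. ($A_4$) $A\colon X\to X^*$ is pseudomonotone, and there is a constant $m_A>0$ such that $\langle Av_1-Av_2,v_1-v_2\rangle\ge m_A\|v_1-v_2\|_X^2$ for all $v_1,v_2\in X$. ($A_5$) $\varphi\colon X_\varphi\times X_\varphi\to\mathbb{R}$ is such that $\varphi(z,\cdot)\colon X_\varphi\to\mathbb{R}$ is convex and lower semicontinuous for all $z\in X_\varphi$, and for a constant $\alpha_\varphi\ge 0$, \[ \varphi(z_1,z_4)-\varphi(z_1,z_3)+\varphi(z_2,z_3)-\varphi(z_2,z_4)\le\alpha_\varphi\|z_1-z_2\|_{X_\varphi}\|z_3-z_4\|_{X_\varphi}\quad\forall\,z_1,z_2,z_3,z_4\in X_\varphi. \] ($A_7$)$''$ $\alpha_\varphi c_\varphi^2<m_A$. ($A_8$) $f\in X^*$. ($A_9$) For each discretization parameter $h>0$, $X^h\subset X$ is a finite dimensional subspace; for any $v\in X$ there exist $v^h\in X^h$ such that $\lim_{h\to 0}\|v^h-v\|_X=0$; and for any $v\in K$ there exist $v^h\in X^h\cap K$ such that $\lim_{h\to 0}\|v^h-v\|_X=0$. ($A_{10}$)$''$ $\gamma_\varphi\colon X\to X_\varphi$ is compact. Let $P\colon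 X\to X^*$ be a penalty operator for $K$. Let $u\in K$ be the unique solution of the variational inequality \[ \langle Au,v-u\rangle+\varphi(\gamma_\varphi u,\gamma_\varphi v)-\varphi(\gamma_\varphi u,\gamma_\varphi u)\ge\langle f,v-u\rangle\quad\forall\,v\in K, \] and, for $h,\epsilon>0$, let $u^h_\epsilon\in X^h$ be the unique solution of \[ \langle Au^h_\epsilon,v^h-u^h_\epsilon\rangle+\frac1\epsilon\langle Pu^h_\epsilon,v^h-u^h_\epsilon\rangle+\varphi(\gamma_\varphi u^h_\epsilon,\gamma_\varphi v^h)-\varphi(\gamma_\varphi u^h_\epsilon,\gamma_\varphi u^h_\epsilon)\ge\langle f,v^h-u^h_\epsilon\rangle\quad\forall\,v^h\in X^h. \] Then \[ u^h_\epsilon\to u\quad\text{in }X\text{ as }h,\epsilon\to 0. \]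
   Context: All spaces are real. $X^*$ is the dual of $X$, $\langle\cdot,\cdot\rangle$ is the duality pairing of $X^*$ and $X$, and $\mathcal{L}(X,Y)$ is the space of continuous linear operators from $X$ to $Y$; $\rightharpoonup$ denotes weak convergence. An operator $A\colon X\to X^*$ is pseudomonotone if it is bounded (maps bounded sets to bounded sets) and $u_n\rightharpoonup u$ in $X$ together with $\limsup_{n\to\infty}\langle Au_n,u_n-u\rangle\le 0$ imply $\langle Au,u-v\rangle\le\liminf_{n\to\infty}\langle Au_n,u_n-v\rangle$ for all $v\in X$. It is demicontinuous if $u_n\to u$ in $X$ implies $Au_n\rightharpoonup Au$ in $X^*$. A penalty operator for the set $K$ is an operator $P\colon X\to X^*$ that is bounded (maps bounded sets to bounded sets), demicontinuous, monotone, and satisfies $\mathrm{Ker}(P)=\{v\in X: Pv=0\}=K$. Under ($A_1$), ($A_2$), ($A_4$), ($A_5$), ($A_7$)$''$, ($A_8$), both the constrained inequality on $K$ and the discrete penalized inequality on $X^h$ have unique solutions. The parameters $h$ and $\epsilon$ tend to zero simultaneously and independently: the convergence means that for every $\eta>0$ there are $h_0,\epsilon_0>0$ such that $\|u^h_\epsilon-u\|_X<\eta$ whenever $0<h<h_0$ and $0<\epsilon<\epsilon_0$. *)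

theory Defs
  imports "HOL-Analysis.Analysis"
begin

text \<open>The dual of a real normed space \<open>'a\<close> is the normed space \<open>'a \<Rightarrow>\<^sub>L real\<close>,
  and the duality pairing of \<open>\<xi>\<close> and \<open>v\<close> is the application \<open>blinfun_apply \<xi> v\<close>.\<close>

definition canonical_embedding :: "'a::real_normed_vector \<Rightarrow> ('a \<Rightarrow>\<^sub>L real) \<Rightarrow>\<^sub>L real" where
  "canonical_embedding x = Blinfun (\<lambda>\<xi>. blinfun_apply \<xi> x)"

lemma canonical_embedding_apply [simp]:
  "blinfun_apply (canonical_embedding x) \<xi> = blinfun_apply \<xi> x"
  unfolding canonical_embedding_def
  by (subst bounded_linear_Blinfun_apply) (auto intro: bounded_linear_intros)

definition reflexive_space :: "'a::real_normed_vector itself \<Rightarrow> bool" where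
  "reflexive_space _ \<longleftrightarrow>
     surj (canonical_embedding :: 'a \<Rightarrow> ('a \<Rightarrow>\<^sub>L real) \<Rightarrow>\<^sub>L real)"

definition weakly_converges :: "(nat \<Rightarrow> 'a::real_normed_vector) \<Rightarrow> 'a \<Rightarrow> bool" where
  "weakly_converges x l \<longleftrightarrow>
     (\<forall>\<xi> :: 'a \<Rightarrow>\<^sub>L real. (\<lambda>n. blinfun_apply \<xi> (x n)) \<longlonglongrightarrow> blinfun_apply \<xi> l)"

definition bounded_operator :: "('a::metric_space \<Rightarrow> 'b::metric_space) \<Rightarrow> bool" where
  "bounded_operator T \<longleftrightarrow> (\<forall>S. bounded S \<longrightarrow> bounded (T ` S))"

definition compact_operator :: "('a::metric_space \<Rightarrow> 'b::metric_space) \<Rightarrow> bool" where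
  "compact_operator T \<longleftrightarrow> (\<forall>S. bounded S \<longrightarrow> compact (closure (T ` S)))"

text \<open>The upper and lower limits are taken in the extended reals, where they always exist.\<close>

definition pseudomonotone :: "('a::real_normed_vector \<Rightarrow> 'a \<Rightarrow>\<^sub>L real) \<Rightarrow> bool" where
  "pseudomonotone A \<longleftrightarrow> bounded_operator A \<and>
     (\<forall>x l. weakly_converges x l \<and>
        limsup (\<lambda>n. ereal (blinfun_apply (A (x n)) (x n - l))) \<le> 0 \<longrightarrow>
        (\<forall>v. ereal (blinfun_apply (A l) (l - v))
               \<le> liminf (\<lambda>n. ereal (blinfun_apply (A (x n)) (x n - v)))))"

text \<open>Weak convergence of \<open>A (x n)\<close> is meant in the normed space \<open>'a \<Rightarrow>\<^sub>L real\<close>, that is,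
  tested against all elements of the bidual.\<close>

definition demicontinuous :: "('a::real_normed_vector \<Rightarrow> 'a \<Rightarrow>\<^sub>L real) \<Rightarrow> bool" where
  "demicontinuous A \<longleftrightarrow>
     (\<forall>x l. x \<longlonglongrightarrow> l \<longrightarrow> weakly_converges (\<lambda>n. A (x n)) (A l))"

definition monotone_operator :: "('a::real_normed_vector \<Rightarrow> 'a \<Rightarrow>\<^sub>L real) \<Rightarrow> bool" where
  "monotone_operator A \<longleftrightarrow> (\<forall>v w. blinfun_apply (A v - A w) (v - w) \<ge> 0)"

definition penalty_operator ::
  "'a::real_normed_vector set \<Rightarrow> ('a \<Rightarrow> 'a \<Rightarrow>\<^sub>L real) \<Rightarrow> bool" where
  "penalty_operator K P \<longleftrightarrow>
     bounded_operator P \<and> demicontinuous P \<and> monotone_operator P \<and> {v. P v = 0} = K"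

definition lower_semicontinuous :: "('a::topological_space \<Rightarrow> real) \<Rightarrow> bool" where
  "lower_semicontinuous g \<longleftrightarrow> (\<forall>x. \<forall>c < g x. \<forall>\<^sub>F y in nhds x. c < g y)"

definition finite_dim_subspace :: "'a::real_vector set \<Rightarrow> bool" where
  "finite_dim_subspace V \<longleftrightarrow> subspace V \<and> (\<exists>B. finite B \<and> span B = V)"

end

theory Submission
  imports Defs
begin

text \<open>Comparing the discrete inequality with a recovery sequence in \<open>Xh h \<inter> K\<close> bounds the discrete
  solutions \<open>uh h \<epsilon>\<close>. Along a filter finer than that of \<open>h, \<epsilon> \<rightarrow> 0\<close> they have a weak limit \<open>l\<close>, and
  \<open>\<langle>P w, l - w\<rangle> \<le> 0\<close> for all \<open>w\<close> by monotonicity of \<open>P\<close>, so Minty's trick gives \<open>P l = 0\<close>, that is,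
  \<open>l \<in> K\<close>. The functional \<open>g v = \<langle>A u - f, v\<rangle> + \<phi> (\<gamma> u) (\<gamma> v)\<close> is convex and continuous, and \<open>u\<close> minimizes
  it on \<open>K\<close>. Strong monotonicity of \<open>A\<close> and the condition on \<open>\<phi>\<close> bound
  \<open>(m - \<alpha> c\<^sup>2) \<parallel>uh h \<epsilon> - u\<parallel>\<^sup>2\<close> by \<open>g u - g (uh h \<epsilon>)\<close> up to terms tending to zero; a subgradient of
  \<open>g\<close> at \<open>l\<close> and \<open>g u \<le> g l\<close> make the limit of this bound nonpositive along the finer filter.\<close>

section \<open>Sublinear functionals and the Hahn-Banach theorem\<close>

definition sublinear :: "('a::real_vector \<Rightarrow> real) \<Rightarrow> bool" where
  "sublinear p \<longleftrightarrow> (\<forall>x y. p (x + y) \<le> p x + p y) \<and> (\<forall>t>0. \<forall>x. p (t *\<^sub>R x) \<le> t * p x)"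

lemma sublinearI:
  assumes "\<And>x y. p (x + y) \<le> p x + p y" "\<And>t x. t > 0 \<Longrightarrow> p (t *\<^sub>R x) \<le> t * p x"
  shows "sublinear p"
  using assms by (auto simp: sublinear_def)

lemma sublinear_add: "sublinear p \<Longrightarrow> p (x + y) \<le> p x + p y"
  by (auto simp: sublinear_def)

lemma sublinear_scale_le: "sublinear p \<Longrightarrow> t > 0 \<Longrightarrow> p (t *\<^sub>R x) \<le> t * p x"
  by (auto simp: sublinear_def)

lemma sublinear_zero:
  assumes "sublinear p"
  shows "p 0 = 0"
  using sublinear_add[OF assms, of 0 0] sublinear_scale_le[OF assms, of "1/2" 0] by simp

text \<open>The reverse inequality is the defining one for the factor \<open>1 / t\<close> at
  \<open>t *\<^sub>R x\<close>. This is why the definition demands only an inequality, which is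
  easier to check for infima.\<close>

lemma sublinear_scale:
  assumes "sublinear p" "t \<ge> 0"
  shows "p (t *\<^sub>R x) = t * p x"
proof (cases "t = 0")
  case False
  with assms have "t > 0" by simp
  then have "p ((1/t) *\<^sub>R (t *\<^sub>R x)) \<le> (1/t) * p (t *\<^sub>R x)"
    by (intro sublinear_scale_le assms) simp
  with \<open>t > 0\<close> have "t * p x \<le> p (t *\<^sub>R x)"
    by (simp add: field_simps)
  with sublinear_scale_le[OF assms(1) \<open>t > 0\<close>, of x] show ?thesis by simp
qed (use assms sublinear_zero in auto)

lemma sublinear_minus_le:
  assumes "sublinear p"
  shows "- p (- x) \<le> p x"
  using sublinear_add[OF assms, of x "- x"] sublinear_zero[OF assms] by simp

text \<open>The infima are taken one at a time, first over \<open>b\<close> with \<open>a\<close>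
  fixed. This serves to prove subadditivity of functionals defined as infima.\<close>

lemma le_INF_add:
  fixes F :: "'i \<Rightarrow> real"
  assumes "S \<noteq> {}" "T \<noteq> {}" "\<And>a b. a \<in> S \<Longrightarrow> b \<in> T \<Longrightarrow> z \<le> F a + G b"
  shows "z \<le> (INF a\<in>S. F a) + (INF b\<in>T. G b)"
proof -
  have "z - F a \<le> (INF b\<in>T. G b)" if "a \<in> S" for a
    using assms that by (intro cINF_greatest) (auto simp: algebra_simps)
  then have "z - (INF b\<in>T. G b) \<le> (INF a\<in>S. F a)"
    using assms by (intro cINF_greatest) (auto simp: algebra_simps)
  then show ?thesis by simp
qed

text \<open>Provides lower bounds of chains for Zorn's lemma. Of two members of the chain the
  smaller one serves both arguments, which gives subadditivity.\<close>

lemma sublinear_INF_chain: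
  assumes C: "C \<noteq> {}" "\<And>q. q \<in> C \<Longrightarrow> sublinear q" "\<And>q r. q \<in> C \<Longrightarrow> r \<in> C \<Longrightarrow> q \<le> r \<or> r \<le> q"
    and bdd: "\<And>x. bdd_below ((\<lambda>q. q x) ` C)"
  shows "sublinear (\<lambda>x. INF q\<in>C. q x)"
proof (rule sublinearI)
  have lower: "(INF q\<in>C. q x) \<le> q x" if "q \<in> C" for q x
    using bdd that by (rule cINF_lower)
  show "(INF q\<in>C. q (x + y)) \<le> (INF q\<in>C. q x) + (INF q\<in>C. q y)" for x y
  proof (rule le_INF_add[OF C(1) C(1)])
    fix q r assume qr: "q \<in> C" "r \<in> C"
    then consider "q \<le> r" | "r \<le> q" using C(3) by blast
    then show "(INF q\<in>C. q (x + y)) \<le> q x + r y"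
    proof cases
      case 1
      then show ?thesis
        using lower[OF qr(1), of "x + y"] sublinear_add[OF C(2)[OF qr(1)], of x y] le_funD[of q r y]
        by linarith
    next
      case 2
      then show ?thesis
        using lower[OF qr(2), of "x + y"] sublinear_add[OF C(2)[OF qr(2)], of x y] le_funD[of r q x]
        by linarith
    qed
  qed
  show "(INF q\<in>C. q (t *\<^sub>R x)) \<le> t * (INF q\<in>C. q x)" if "t > 0" for t x
  proof -
    have "(INF q\<in>C. q (t *\<^sub>R x)) / t \<le> (INF q\<in>C. q x)"
    proof (rule cINF_greatest[OF C(1)])
      fix q assume "q \<in> C"
      then show "(INF q\<in>C. q (t *\<^sub>R x)) / t \<le> q x"
        using lower[of q "t *\<^sub>R x"] sublinear_scale_le[OF C(2), of q t x] that
        by (simp add: field_simps)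
    qed
    with that show ?thesis by (simp add: field_simps)
  qed
qed

text \<open>The auxiliary functional \<open>r\<close> is sublinear and lies below \<open>q\<close>
  by the choice \<open>s = 0\<close>, so minimality forces \<open>r = q\<close>; the choice
  \<open>s = 1\<close> then gives the missing inequality
  \<open>q x + q y \<le> q (x + y)\<close>.\<close>

lemma sublinear_minimal_additive:
  assumes q: "sublinear q" and minimal: "\<And>r. sublinear r \<Longrightarrow> r \<le> q \<Longrightarrow> r = q"
  shows "q (x + y) = q x + q y"
proof -
  define r where "r x = (INF s\<in>{0..}. q (x + s *\<^sub>R y) - s * q y)" for x
  \<comment> \<open>Subadditivity at \<open>x + s *\<^sub>R y\<close> and \<open>- x\<close> keeps
    the infimum finite.\<close>
  have lb: "- q (- x) \<le> q (x + s *\<^sub>R y) - s * q y" if "s \<ge> 0" for x s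
    using sublinear_add[OF q, of "x + s *\<^sub>R y" "- x"] sublinear_scale[OF q that, of y] by simp
  have lower: "r x \<le> q (x + s *\<^sub>R y) - s * q y" if "s \<ge> 0" for x s
    unfolding r_def using lb that by (intro cINF_lower bdd_belowI2[of _ "- q (- x)"]) auto
  have "sublinear r"
  proof (rule sublinearI)
    show "r (x1 + x2) \<le> r x1 + r x2" for x1 x2
      unfolding r_def[of x1] r_def[of x2]
    proof (rule le_INF_add)
      fix s t :: real assume "s \<in> {0..}" "t \<in> {0..}"
      then show "r (x1 + x2) \<le> (q (x1 + s *\<^sub>R y) - s * q y) + (q (x2 + t *\<^sub>R y) - t * q y)"
        using lower[of "s + t" "x1 + x2"] sublinear_add[OF q, of "x1 + s *\<^sub>R y" "x2 + t *\<^sub>R y"]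
        by (simp add: algebra_simps)
    qed auto
    show "r (t *\<^sub>R x) \<le> t * r x" if "t > 0" for t x
    proof -
      have "r (t *\<^sub>R x) / t \<le> r x"
        unfolding r_def[of x]
      proof (rule cINF_greatest)
        fix s :: real assume "s \<in> {0..}"
        with that show "r (t *\<^sub>R x) / t \<le> q (x + s *\<^sub>R y) - s * q y"
          using lower[of "t * s" "t *\<^sub>R x"] sublinear_scale_le[OF q that, of "x + s *\<^sub>R y"]
          by (simp add: field_simps)
      qed auto
      with that show ?thesis by (simp add: field_simps)
    qed
  qed
  moreover have "r \<le> q"
    using lower[of 0] by (auto simp: le_fun_def)
  ultimately have "r = q" by (rule minimal)
  with lower[of 1 x] have "q x \<le> q (x + y) - q y" by simp
  with sublinear_add[OF q, of x y] show ?thesis by simp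
qed

text \<open>The Hahn--Banach theorem: a minimal sublinear functional below \<open>p\<close> is linear.\<close>

theorem sublinear_dominates_linear:
  fixes p :: "'a::real_vector \<Rightarrow> real"
  assumes p: "sublinear p"
  shows "\<exists>l. linear l \<and> (\<forall>x. l x \<le> p x)"
proof -
  define Q where "Q = {q. sublinear q \<and> q \<le> p}"
  have "\<exists>q\<in>Q. \<forall>r\<in>Q. r \<le> q \<longrightarrow> r = q"
  \<comment> \<open>The order is reversed, so that Zorn's lemma yields a minimal element.\<close>
  proof (rule predicate_Zorn)
    show "partial_order_on Q (relation_of (\<lambda>q r. r \<le> q) Q)"
      by (rule partial_order_on_relation_ofI) auto
    fix C assume C: "C \<in> Chains (relation_of (\<lambda>q r. r \<le> q) Q)"
    then have CQ: "q \<in> Q" if "q \<in> C" for q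
      using that by (auto simp: Chains_def relation_of_def)
    have tot: "q \<le> r \<or> r \<le> q" if "q \<in> C" "r \<in> C" for q r
      using C that by (auto simp: Chains_def relation_of_def)
    show "\<exists>u\<in>Q. \<forall>q\<in>C. u \<le> q"
    proof (cases "C = {}")
      case True
      with p show ?thesis by (auto simp: Q_def)
    next
      case False
      \<comment> \<open>A bound independent of \<open>q\<close>, from
        \<open>- p (- x) \<le> - q (- x) \<le> q x\<close>; it makes the infimum over the chain
        finite.\<close>
      have lb: "- p (- x) \<le> q x" if "q \<in> C" for q x
        using sublinear_minus_le[of q x] CQ[OF that] le_funD[of q p "- x"] by (force simp: Q_def)
      then have bdd: "bdd_below ((\<lambda>q. q x) ` C)" for x
        by (intro bdd_belowI2)
      define r where "r x = (INF q\<in>C. q x)" for x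
      have r_le: "r \<le> q" if "q \<in> C" for q
        unfolding le_fun_def r_def using cINF_lower[OF bdd that] by blast
      have "sublinear r"
        unfolding r_def using False CQ tot bdd by (intro sublinear_INF_chain) (auto simp: Q_def)
      moreover have "r \<le> p"
        using False CQ r_le by (fastforce simp: Q_def intro: order_trans)
      ultimately show ?thesis
        using r_le by (auto simp: Q_def)
    qed
  qed
  then obtain q where q: "sublinear q" "q \<le> p"
    and minimal: "\<And>r. sublinear r \<Longrightarrow> r \<le> p \<Longrightarrow> r \<le> q \<Longrightarrow> r = q"
    by (auto simp: Q_def)
  have add: "q (x + y) = q x + q y" for x y
    using q minimal by (intro sublinear_minimal_additive) (auto intro: order_trans)
  have neg: "q (- x) = - q x" for x
    using add[of x "- x"] sublinear_zero[OF q(1)] by simp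
  have "q (t *\<^sub>R x) = t * q x" for t x
    using sublinear_scale[OF q(1), of t x] sublinear_scale[OF q(1), of "- t" x] neg[of "t *\<^sub>R x"]
    by (cases "t \<ge> 0") auto
  then have "linear q"
    using add by (intro linearI) auto
  with q(2) show ?thesis by (auto simp: le_fun_def)
qed

section \<open>Subgradients of convex functions\<close>

lemma convex_on_sublinear_minorant:
  fixes g :: "'a::real_vector \<Rightarrow> real"
  assumes g: "convex_on UNIV g"
  shows "\<exists>p. sublinear p \<and> (\<forall>d. p d \<le> g (x + d) - g x)"
proof -
  \<comment> \<open>\<open>p\<close> is the one-sided directional derivative of \<open>g\<close> at
    \<open>x\<close>, written as an infimum of difference quotients so that no limit has to be
    taken.\<close>
  define Q where "Q t d = (g (x + t *\<^sub>R d) - g x) / t" for t d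
  define p where "p d = (INF t\<in>{0<..}. Q t d)" for d
  \<comment> \<open>The point \<open>x + \<tau> (d + d')\<close> with \<open>1 / \<tau> = 1 / s + 1 / t\<close> lies on the segment
    from \<open>x + s d\<close> to \<open>x + t d'\<close>.\<close>
  have Q_add: "Q (s * t / (s + t)) (d + d') \<le> Q s d + Q t d'" if "s > 0" "t > 0" for s t d d'
  proof -
    have e1: "(1 - s / (s + t)) = t / (s + t)" using that by (simp add: field_simps)
    have *: "x + (s * t / (s + t)) *\<^sub>R (d + d')
      = (1 - s / (s + t)) *\<^sub>R (x + s *\<^sub>R d) + (s / (s + t)) *\<^sub>R (x + t *\<^sub>R d')"
      unfolding scaleR_add_right scaleR_diff_left e1
      using that by (simp add: e1 algebra_simps flip: scaleR_add_left add_divide_distrib)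
    have "g (x + (s * t / (s + t)) *\<^sub>R (d + d'))
      \<le> (1 - s / (s + t)) * g (x + s *\<^sub>R d) + (s / (s + t)) * g (x + t *\<^sub>R d')"
      unfolding * using that by (intro convex_onD[OF g]) auto
    then have "Q (s * t / (s + t)) (d + d')
      \<le> ((t / (s + t)) * g (x + s *\<^sub>R d) + (s / (s + t)) * g (x + t *\<^sub>R d') - g x) / (s * t / (s + t))"
      unfolding Q_def e1 using that by (intro divide_right_mono) auto
    also have "\<dots> = Q s d + Q t d'"
      unfolding Q_def using that by (simp add: divide_simps) (simp add: algebra_simps)
    finally show ?thesis .
  qed
  \<comment> \<open>\<open>Q_add\<close> for the directions \<open>d\<close> and \<open>- d\<close>,
    whose sum has quotient 0.\<close>
  have lb: "- Q 1 (- d) \<le> Q t d" if "t > 0" for t d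
    using Q_add[OF that, of 1 d "- d"] by (simp add: Q_def)
  have lower: "p d \<le> Q t d" if "t > 0" for t d
    unfolding p_def using that lb by (intro cINF_lower bdd_belowI2[of _ "- Q 1 (- d)"]) auto
  have "sublinear p"
  proof (rule sublinearI)
    show "p (d + d') \<le> p d + p d'" for d d'
      unfolding p_def[of d] p_def[of d']
    proof (rule le_INF_add)
      fix s t :: real assume "s \<in> {0<..}" "t \<in> {0<..}"
      then show "p (d + d') \<le> Q s d + Q t d'"
        using lower[of "s * t / (s + t)" "d + d'"] Q_add[of s t d d'] by simp
    qed auto
    show "p (t *\<^sub>R d) \<le> t * p d" if "t > 0" for t d
    proof -
      have "p (t *\<^sub>R d) / t \<le> p d"
        unfolding p_def[of d]
      proof (rule cINF_greatest)
        fix s :: real assume "s \<in> {0<..}"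
        with that show "p (t *\<^sub>R d) / t \<le> Q s d"
          using lower[of "s / t" "t *\<^sub>R d"] by (simp add: Q_def field_simps)
      qed auto
      with that show ?thesis by (simp add: field_simps)
    qed
  qed
  moreover have "p d \<le> g (x + d) - g x" for d
    using lower[of 1 d] by (simp add: Q_def)
  ultimately show ?thesis by blast
qed

text \<open>A linear functional below the sublinear minorant of the increments satisfies the
  subgradient inequality; continuity of \<open>g\<close> at \<open>x\<close> makes it
  bounded.\<close>

theorem convex_on_subgradient:
  fixes g :: "'a::real_normed_vector \<Rightarrow> real"
  assumes g: "convex_on UNIV g" "isCont g x"
  shows "\<exists>\<xi> :: 'a \<Rightarrow>\<^sub>L real. \<forall>y. g x + \<xi> (y - x) \<le> g y"
proof -
  obtain l where l: "linear l" "\<And>d. l d \<le> g (x + d) - g x"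
    using convex_on_sublinear_minorant[OF g(1), of x] sublinear_dominates_linear order_trans by metis
  obtain r where r: "r > 0" "\<And>y. dist y x < r \<Longrightarrow> dist (g y) (g x) < 1"
    using g(2) unfolding continuous_at_eps_delta by (metis zero_less_one)
  have small: "l d \<le> 1" if "norm d < r" for d
    using l(2)[of d] r(2)[of "x + d"] that by (auto simp: dist_norm)
  have "norm (l d) \<le> norm d * (2 / r)" for d
  proof (cases "d = 0")
    case False
    \<comment> \<open>This factor puts \<open>t *\<^sub>R d\<close> on the sphere of radius
      \<open>r / 2\<close>, where \<open>small\<close> applies to it and to its negative; hence the
      constant \<open>2 / r\<close>.\<close>
    define t where "t = r / (2 * norm d)"
    have t: "t > 0" "norm (t *\<^sub>R d) < r"
      using False r(1) by (auto simp: t_def)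
    then have "\<bar>l (t *\<^sub>R d)\<bar> \<le> 1"
      using small[of "t *\<^sub>R d"] small[of "- (t *\<^sub>R d)"] linear_neg[OF l(1), of "t *\<^sub>R d"] by auto
    then have "t * \<bar>l d\<bar> \<le> 1"
      using t by (simp add: linear_scale[OF l(1)] abs_mult)
    with False r(1) show ?thesis
      by (simp add: t_def field_simps)
  qed (simp add: linear_0[OF l(1)])
  then have "bounded_linear l"
    by (intro bounded_linear_intro[where K = "2 / r"]) (auto simp: linear_add[OF l(1)] linear_scale[OF l(1)])
  then have "g x + Blinfun l (y - x) \<le> g y" for y
    using l(2)[of "y - x"] by (simp add: bounded_linear_Blinfun_apply)
  then show ?thesis by blast
qed

section \<open>Continuity of convex lower semicontinuous functions\<close>

lemma lower_semicontinuous_closed_sublevel: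
  assumes "lower_semicontinuous g"
  shows "closed {x. g x \<le> b}"
proof -
  have "open {x. b < g x}"
    unfolding open_subopen[of "{x. b < g x}"]
  proof
    fix x assume "x \<in> {x. b < g x}"
    with assms have "\<forall>\<^sub>F y in nhds x. b < g y"
      by (auto simp: lower_semicontinuous_def)
    then show "\<exists>T. open T \<and> x \<in> T \<and> T \<subseteq> {x. b < g x}"
      by (auto simp: eventually_nhds)
  qed
  moreover have "- {x. g x \<le> b} = {x. b < g x}" by auto
  ultimately show ?thesis by (simp add: closed_def)
qed

text \<open>The closed sublevel sets at natural heights cover the space, so by Baire's theorem one
  of them contains a ball; convexity carries the bound to a neighbourhood of any
  \<open>x\<close>.\<close>

lemma convex_lower_semicontinuous_locally_bounded:
  fixes g :: "'a::banach \<Rightarrow> real"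
  assumes g: "convex_on UNIV g" "lower_semicontinuous g"
  shows "\<exists>r>0. \<exists>M. \<forall>d. norm d < r \<longrightarrow> g (x + d) \<le> M"
proof -
  let ?S = "\<lambda>n::nat. {x. g x \<le> real n}"
  have "\<exists>n. interior (?S n) \<noteq> {}"
  proof (rule ccontr)
    assume "\<not> ?thesis"
    then have "euclidean interior_of \<Union>(range ?S) = {}"
      using lower_semicontinuous_closed_sublevel[OF g(2)]
      by (intro Baire_category_alt) (auto simp: completely_metrizable_space_euclidean)
    moreover have "\<Union>(range ?S) = UNIV"
      using real_arch_simple by auto
    ultimately show False
      by simp
  qed
  then obtain n y r where r: "r > 0" "ball y r \<subseteq> ?S n"
    by (metis ex_in_conv mem_interior)
  \<comment> \<open>Every point near \<open>x\<close> is the midpoint of a point of the ball and of the reflection of \<open>y\<close> in \<open>x\<close>.\<close>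
  have "g (x + d) \<le> (real n + g (2 *\<^sub>R x - y)) / 2" if "norm d < r / 2" for d
  proof -
    have "y + 2 *\<^sub>R d \<in> ball y r" using that by (simp add: dist_norm)
    then have "g (y + 2 *\<^sub>R d) \<le> real n" using r(2) by auto
    moreover have "x + d = (1 - 1/2) *\<^sub>R (y + 2 *\<^sub>R d) + (1/2) *\<^sub>R (2 *\<^sub>R x - y)"
      by (simp add: algebra_simps)
    then have "g (x + d) \<le> (1 - 1/2) * g (y + 2 *\<^sub>R d) + (1/2) * g (2 *\<^sub>R x - y)"
      using convex_onD[OF g(1), of "1/2" "y + 2 *\<^sub>R d" "2 *\<^sub>R x - y"] by simp
    ultimately show ?thesis by simp
  qed
  with r(1) show ?thesis by (meson half_gt_zero)
qed

text \<open>Lower semicontinuity is one half. For the other half, a point near \<open>x\<close> is a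
  convex combination of \<open>x\<close> and a point where \<open>g\<close> is at most
  \<open>M\<close>, with a small weight \<open>t\<close> on the latter.\<close>

theorem convex_lower_semicontinuous_isCont:
  fixes g :: "'a::banach \<Rightarrow> real"
  assumes g: "convex_on UNIV g" "lower_semicontinuous g"
  shows "isCont g x"
proof -
  obtain r M where r: "r > 0" "\<And>d. norm d < r \<Longrightarrow> g (x + d) \<le> M"
    using convex_lower_semicontinuous_locally_bounded[OF g] by metis
  have "\<forall>\<^sub>F y in at x. b < g y" if "b < g x" for b
    using g(2) that by (auto simp: lower_semicontinuous_def intro: eventually_nhds_conv_at[THEN iffD1, THEN conjunct1])
  moreover have "\<forall>\<^sub>F y in at x. g y < b" if "g x < b" for b
  proof -
    have "((\<lambda>t. (1 - t) * g x + t * M) \<longlongrightarrow> (1 - 0) * g x + 0 * M) (at_right 0)"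
      by (intro tendsto_intros)
    then have "\<forall>\<^sub>F t in at_right 0. (1 - t) * g x + t * M < b \<and> t < 1 \<and> 0 < t"
      using that by (intro eventually_conj order_tendstoD(2)[where a = b] eventually_at_right_less
          eventually_at_rightI[of 0 1]) auto
    then obtain t where t: "(1 - t) * g x + t * M < b" "0 < t" "t < 1"
      by (auto dest!: eventually_happens)
    \<comment> \<open>With radius \<open>t * r\<close>, stretching \<open>y - x\<close> by
      \<open>1 / t\<close> still stays in the ball on which \<open>M\<close> is a bound.\<close>
    have "g y < b" if "dist y x < t * r" for y
    proof -
      define d where "d = (1/t) *\<^sub>R (y - x)"
      have "norm d < r" using that t by (simp add: d_def dist_norm pos_divide_less_eq mult.commute)
      then have "g (x + d) \<le> M" by (rule r(2))
      have "y = (1 - t) *\<^sub>R x + t *\<^sub>R (x + d)"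
        using t by (simp add: d_def algebra_simps)
      then have "g y \<le> (1 - t) * g x + t * g (x + d)"
        using convex_onD[OF g(1), of t x "x + d"] t by simp
      also have "\<dots> \<le> (1 - t) * g x + t * M"
        using t \<open>g (x + d) \<le> M\<close> by simp
      finally show ?thesis using t by simp
    qed
    then show ?thesis
      using t r(1) by (auto simp: eventually_at intro!: exI[of _ "t * r"])
  qed
  ultimately show ?thesis
    unfolding isCont_def by (intro order_tendstoI)
qed

section \<open>Weak cluster points in reflexive spaces\<close>

text \<open>A bounded family is, by evaluation, a family in a product of compact intervals indexed by
  the dual space. A cluster point there is a bounded linear functional on the dual, which
  reflexivity turns into a point. Working with filters instead of subsequences avoids the
  Eberlein--Smulian theorem.\<close>

theorem reflexive_space_weak_cluster_point:
  fixes x :: "'i \<Rightarrow> 'a::real_normed_vector"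
  assumes refl: "reflexive_space TYPE('a)" and F: "F \<noteq> bot"
    and bound: "\<forall>\<^sub>F i in F. norm (x i) \<le> R"
  shows "\<exists>G l. G \<le> F \<and> G \<noteq> bot \<and> (\<forall>\<xi> :: 'a \<Rightarrow>\<^sub>L real. ((\<lambda>i. \<xi> (x i)) \<longlongrightarrow> \<xi> l) G)"
proof -
  define e where "e i \<xi> = blinfun_apply \<xi> (x i)" for i and \<xi> :: "'a \<Rightarrow>\<^sub>L real"
  define U where "U = PiE UNIV (\<lambda>\<xi> :: 'a \<Rightarrow>\<^sub>L real. {- (R * norm \<xi>)..R * norm \<xi>})"
  \<comment> \<open>Tychonoff's theorem.\<close>
  have "compactin (product_topology (\<lambda>_. euclidean) UNIV) U"
    unfolding U_def compactin_PiE by auto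
  then have "compact U"
    by (simp add: euclidean_product_topology)
  have "\<forall>\<^sub>F i in F. e i \<in> U"
    using bound
  proof eventually_elim
    case (elim i)
    have "\<bar>\<xi> (x i)\<bar> \<le> R * norm \<xi>" for \<xi> :: "'a \<Rightarrow>\<^sub>L real"
      using norm_blinfun[of \<xi> "x i"] mult_left_mono[OF elim, of "norm \<xi>"] by (simp add: mult.commute)
    then show ?case
      by (auto simp: U_def e_def abs_le_iff) (metis minus_le_iff)
  qed
  then have "\<forall>\<^sub>F y in filtermap e F. y \<in> U"
    by (simp add: eventually_filtermap)
  moreover have "filtermap e F \<noteq> bot"
    using F by (simp add: filtermap_bot_iff)
  ultimately obtain L where L: "L \<in> U" "inf (nhds L) (filtermap e F) \<noteq> bot"
    using \<open>compact U\<close>[unfolded compact_filter, rule_format, of "filtermap e F"] by blast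
  \<comment> \<open>\<open>G\<close> refines \<open>F\<close> just enough for \<open>e\<close> to
    converge to \<open>L\<close>; it is proper because \<open>L\<close> is a cluster point.\<close>
  define G where "G = inf F (filtercomap e (nhds L))"
  have "G \<noteq> bot"
  proof
    assume "G = bot"
    then obtain P Q where PQ: "eventually P F" "eventually Q (nhds L)" "\<And>i. P i \<Longrightarrow> Q (e i) \<Longrightarrow> False"
      unfolding G_def trivial_limit_def eventually_inf eventually_filtercomap by metis
    from PQ(1) have "eventually (\<lambda>y. \<not> Q y) (filtermap e F)"
      unfolding eventually_filtermap by eventually_elim (use PQ(3) in auto)
    with PQ(2) have "eventually (\<lambda>_. False) (inf (nhds L) (filtermap e F))"
      unfolding eventually_inf by blast
    with L(2) show False by (simp add: trivial_limit_def)
  qed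
  have lim: "((\<lambda>i. \<xi> (x i)) \<longlongrightarrow> L \<xi>) G" for \<xi> :: "'a \<Rightarrow>\<^sub>L real"
  proof -
    have "(e \<longlongrightarrow> L) G"
      unfolding G_def by (rule filterlim_mono[OF filterlim_filtercomap]) auto
    have "((\<lambda>i. e i \<xi>) \<longlongrightarrow> L \<xi>) G"
    proof (rule topological_tendstoI)
      fix S :: "real set" assume S: "open S" "L \<xi> \<in> S"
      have "open ((\<lambda>y :: ('a \<Rightarrow>\<^sub>L real) \<Rightarrow> real. y \<xi>) -` S)"
        using S(1) by (intro open_vimage) auto
      from topological_tendstoD[OF \<open>(e \<longlongrightarrow> L) G\<close> this] S(2)
      show "\<forall>\<^sub>F i in G. e i \<xi> \<in> S" by simp
    qed
    then show ?thesis
      by (simp add: e_def)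
  qed
  \<comment> \<open>Linearity passes to pointwise limits, and membership in \<open>U\<close> gives
    the norm bound.\<close>
  have "bounded_linear L"
  proof (rule bounded_linear_intro[where K = R])
    show "L (\<xi> + \<zeta>) = L \<xi> + L \<zeta>" for \<xi> \<zeta>
      using tendsto_unique[OF \<open>G \<noteq> bot\<close> lim[of "\<xi> + \<zeta>"]] tendsto_add[OF lim lim, of \<xi> \<zeta>]
      by (simp add: blinfun.add_left)
    show "L (t *\<^sub>R \<xi>) = t *\<^sub>R L \<xi>" for t \<xi>
      using tendsto_unique[OF \<open>G \<noteq> bot\<close> lim[of "t *\<^sub>R \<xi>"]] tendsto_scaleR[OF tendsto_const lim, of t \<xi>]
      by (simp add: blinfun.scaleR_left)
    show "norm (L \<xi>) \<le> norm \<xi> * R" for \<xi>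
      using L(1) by (auto simp: U_def PiE_iff abs_le_iff mult.commute) (metis minus_le_iff)
  qed
  moreover obtain l :: 'a where "canonical_embedding l = Blinfun L"
    using refl unfolding reflexive_space_def by (metis surjD)
  ultimately have "L \<xi> = \<xi> l" for \<xi>
    by (metis bounded_linear_Blinfun_apply canonical_embedding_apply)
  with lim \<open>G \<noteq> bot\<close> show ?thesis
    unfolding G_def by (intro exI[of _ G] exI[of _ l]) (auto simp: G_def)
qed

section \<open>Auxiliary bounds and Minty's trick\<close>

lemma bounded_operatorD:
  fixes T :: "'a::real_normed_vector \<Rightarrow> 'b::real_normed_vector"
  assumes "bounded_operator T"
  shows "\<exists>C\<ge>0. \<forall>x. norm x \<le> R \<longrightarrow> norm (T x) \<le> C"
proof -
  have "bounded (T ` cball 0 R)"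
    using assms by (simp add: bounded_operator_def)
  then obtain C where "\<forall>x\<in>T ` cball 0 R. norm x \<le> C"
    unfolding bounded_iff by blast
  \<comment> \<open>The maximum with 0 covers \<open>R < 0\<close>, where the ball is empty and
    \<open>C\<close> may be negative.\<close>
  then show ?thesis
    by (intro exI[of _ "max C 0"]) (auto simp: le_max_iff_disj)
qed

lemma blinfun_abs_le:
  fixes \<xi> :: "'a::real_normed_vector \<Rightarrow>\<^sub>L real"
  assumes "norm \<xi> \<le> C" "norm x \<le> r"
  shows "\<bar>\<xi> x\<bar> \<le> C * r"
proof -
  have "\<bar>\<xi> x\<bar> \<le> norm \<xi> * norm x"
    using norm_blinfun[of \<xi> x] by simp
  also have "\<dots> \<le> C * r"
    using assms norm_ge_zero[of \<xi>] by (intro mult_mono) (auto intro: order_trans[OF norm_ge_zero])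
  finally show ?thesis .
qed

text \<open>Minty's trick: test with \<open>w = l - t z\<close> and let \<open>t\<close> tend to zero.\<close>

lemma demicontinuous_Minty_zero:
  fixes P :: "'a::real_normed_vector \<Rightarrow> 'a \<Rightarrow>\<^sub>L real"
  assumes P: "demicontinuous P" and le: "\<And>w. P w (l - w) \<le> 0"
  shows "P l = 0"
proof -
  have nonpos: "P l z \<le> 0" for z
  proof -
    define t where "t n = inverse (real (Suc n))" for n
    have "t \<longlonglongrightarrow> 0"
      unfolding t_def by (rule LIMSEQ_inverse_real_of_nat)
    then have "(\<lambda>n. l - t n *\<^sub>R z) \<longlonglongrightarrow> l - 0 *\<^sub>R z"
      by (intro tendsto_intros)
    with P have "weakly_converges (\<lambda>n. P (l - t n *\<^sub>R z)) (P l)"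
      by (simp add: demicontinuous_def)
    \<comment> \<open>Weak convergence in the dual is tested against evaluation at
      \<open>z\<close>.\<close>
    then have "(\<lambda>n. canonical_embedding z (P (l - t n *\<^sub>R z))) \<longlonglongrightarrow> canonical_embedding z (P l)"
      unfolding weakly_converges_def by blast
    then have "(\<lambda>n. P (l - t n *\<^sub>R z) z) \<longlonglongrightarrow> P l z"
      by simp
    moreover have "P (l - t n *\<^sub>R z) z \<le> 0" for n
      using le[of "l - t n *\<^sub>R z"] by (simp add: t_def blinfun.scaleR_right mult_le_0_iff)
    ultimately show ?thesis
      by (intro tendsto_upperbound) auto
  qed
  show ?thesis
  proof (rule blinfun_eqI)
    show "P l z = blinfun_apply 0 z" for z
      using nonpos[of z] nonpos[of "- z"] by (simp add: blinfun.minus_right)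
  qed
qed

text \<open>If \<open>s > 1\<close>, then \<open>b \<le> b * s\<close> and a factor \<open>s\<close>
  cancels; the summand 1 covers the other case.\<close>

lemma quadratic_le_linear_bound:
  fixes k s :: real
  assumes "k > 0" "a \<ge> 0" "b \<ge> 0" "s \<ge> 0" "k * s\<^sup>2 \<le> a * s + b"
  shows "s \<le> 1 + (a + b) / k"
proof (cases "s \<le> 1")
  case False
  then have "k * s * s \<le> (a + b) * s"
    using assms mult_left_mono[of 1 s b] by (simp add: power2_eq_square algebra_simps)
  with False have "k * s \<le> a + b" by simp
  then have "s \<le> (a + b) / k" using assms(1) by (simp add: field_simps)
  then show ?thesis by simp
qed (use assms in \<open>simp add: add_increasing2\<close>)

lemma convex_on_compose_linear:
  assumes "linear h" "convex_on UNIV g"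
  shows "convex_on UNIV (\<lambda>x. g (h x))"
  using assms by (auto simp: convex_on_def linear_add linear_scale)

section \<open>Convergence of the penalized discrete solutions\<close>

theorem corollary6p2:
  fixes K :: "'a::banach set"
    and \<gamma> :: "'a \<Rightarrow>\<^sub>L 'b::banach"
    and A P :: "'a \<Rightarrow> 'a \<Rightarrow>\<^sub>L real"
    and \<phi> :: "'b \<Rightarrow> 'b \<Rightarrow> real"
    and f :: "'a \<Rightarrow>\<^sub>L real"
    and c m \<alpha> :: real
    and Xh :: "real \<Rightarrow> 'a set"
    and u :: 'a
    and uh :: "real \<Rightarrow> real \<Rightarrow> 'a"
  assumes A1_reflexive: "reflexive_space TYPE('a)"
    and A1_K: "K \<subset> UNIV" "K \<noteq> {}" "closed K" "convex K"
    and A2: "c > 0" "\<And>v. norm (\<gamma> v) \<le> c * norm v"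
    and A4_pseudomonotone: "pseudomonotone A"
    and A4_strongly_monotone: "m > 0"
      "\<And>v1 v2. blinfun_apply (A v1 - A v2) (v1 - v2) \<ge> m * (norm (v1 - v2))\<^sup>2"
    and A5_convex_lsc: "\<And>z. convex_on UNIV (\<phi> z)" "\<And>z. lower_semicontinuous (\<phi> z)"
    and A5_alpha: "\<alpha> \<ge> 0"
      "\<And>z1 z2 z3 z4. \<phi> z1 z4 - \<phi> z1 z3 + \<phi> z2 z3 - \<phi> z2 z4
         \<le> \<alpha> * norm (z1 - z2) * norm (z3 - z4)"
    and A7: "\<alpha> * c\<^sup>2 < m"
    and A9_subspace: "\<And>h. h > 0 \<Longrightarrow> finite_dim_subspace (Xh h)"
    and A9_approx: "\<And>v. \<exists>vh. (\<forall>h>0. vh h \<in> Xh h) \<and>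
         ((\<lambda>h. norm (vh h - v)) \<longlongrightarrow> 0) (at_right 0)"
    and A9_approx_K: "\<And>v. v \<in> K \<Longrightarrow> \<exists>vh. (\<forall>h>0. vh h \<in> Xh h \<inter> K) \<and>
         ((\<lambda>h. norm (vh h - v)) \<longlongrightarrow> 0) (at_right 0)"
    and A10: "compact_operator (blinfun_apply \<gamma>)"
    and P: "penalty_operator K P"
    and u: "u \<in> K"
      "\<And>v. v \<in> K \<Longrightarrow>
         blinfun_apply (A u) (v - u) + \<phi> (\<gamma> u) (\<gamma> v) - \<phi> (\<gamma> u) (\<gamma> u)
           \<ge> blinfun_apply f (v - u)"
    and uh: "\<And>h \<epsilon>. h > 0 \<Longrightarrow> \<epsilon> > 0 \<Longrightarrow> uh h \<epsilon> \<in> Xh h"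
      "\<And>h \<epsilon> v. h > 0 \<Longrightarrow> \<epsilon> > 0 \<Longrightarrow> v \<in> Xh h \<Longrightarrow>
         blinfun_apply (A (uh h \<epsilon>)) (v - uh h \<epsilon>)
           + (1 / \<epsilon>) * blinfun_apply (P (uh h \<epsilon>)) (v - uh h \<epsilon>)
           + \<phi> (\<gamma> (uh h \<epsilon>)) (\<gamma> v) - \<phi> (\<gamma> (uh h \<epsilon>)) (\<gamma> (uh h \<epsilon>))
           \<ge> blinfun_apply f (v - uh h \<epsilon>)"
  shows "\<forall>\<eta>>0. \<exists>h0>0. \<exists>\<epsilon>0>0. \<forall>h \<epsilon>. 0 < h \<and> h < h0 \<and> 0 < \<epsilon> \<and> \<epsilon> < \<epsilon>0 \<longrightarrow>
           norm (uh h \<epsilon> - u) < \<eta>"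
proof -
  \<comment> \<open>The constant in the condition on \<open>\<phi>\<close> once norms of images
    under \<open>\<gamma>\<close> are bounded by norms in the domain.\<close>
  define k where "k = \<alpha> * c\<^sup>2"
  define \<Psi> where "\<Psi> v = \<phi> (\<gamma> u) (\<gamma> v)" for v
  \<comment> \<open>The product filter expresses that \<open>h\<close> and \<open>\<epsilon>\<close>
    tend to zero independently.\<close>
  define F :: "(real \<times> real) filter" where "F = at_right 0 \<times>\<^sub>F at_right 0"
  define U where "U p = uh (fst p) (snd p)" for p
  have k: "0 \<le> k" "k < m"
    using A5_alpha(1) A7 by (auto simp: k_def)

  have P_mono: "P w (v - w) \<le> P v (v - w)" for v w
    using P by (auto simp: penalty_operator_def monotone_operator_def blinfun.diff_left)
  have P_zero: "P v = 0 \<longleftrightarrow> v \<in> K" for v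
    using P by (auto simp: penalty_operator_def)

  have \<Psi>_convex: "convex_on UNIV \<Psi>"
    unfolding \<Psi>_def
    by (rule convex_on_compose_linear[OF bounded_linear.linear[OF blinfun.bounded_linear_right] A5_convex_lsc(1)])
  have \<Psi>_cont: "isCont \<Psi> v" for v
    unfolding \<Psi>_def
    by (rule isCont_o2[OF linear_continuous_at[OF blinfun.bounded_linear_right]
          convex_lower_semicontinuous_isCont[OF A5_convex_lsc]])
  \<comment> \<open>An affine minorant: \<open>\<Psi>\<close> decreases at most linearly, so the
    quadratic growth from strong monotonicity dominates it.\<close>
  obtain \<zeta> :: "'a \<Rightarrow>\<^sub>L real" where \<zeta>: "\<And>v. \<Psi> u + \<zeta> (v - u) \<le> \<Psi> v"
    using convex_on_subgradient[OF \<Psi>_convex \<Psi>_cont] by metis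
  have \<Psi>_lower: "\<Psi> u - norm \<zeta> * norm (v - u) \<le> \<Psi> v" for v
    using \<zeta>[of v] blinfun_abs_le[OF order_refl order_refl, of \<zeta> "v - u"] by linarith

  have F_pos: "\<forall>\<^sub>F p in F. fst p > 0 \<and> snd p > 0"
    unfolding F_def eventually_prod_filter
    by (intro exI[of _ "\<lambda>x. x > 0"]) (auto simp: eventually_at_right_less)
  have F_fst: "filterlim fst (at_right 0) F"
    unfolding F_def by (rule filterlim_fst)
  have "filterlim snd (at_right 0) F"
    unfolding F_def by (rule filterlim_snd)
  then have F_snd: "(snd \<longlongrightarrow> 0) F"
    by (simp add: filterlim_at)
  have F_approx: "((\<lambda>p. vh (fst p)) \<longlongrightarrow> v) F"
    if "((\<lambda>h. norm (vh h - v)) \<longlongrightarrow> 0) (at_right 0)" for vh :: "real \<Rightarrow> 'a" and v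
  proof -
    have "(vh \<longlongrightarrow> v) (at_right 0)"
      using that by (metis LIM_zero_cancel tendsto_norm_zero_cancel)
    then show ?thesis
      using F_fst by (rule filterlim_compose)
  qed

  \<comment> \<open>The condition on \<open>\<phi>\<close> replaces the first argument
    \<open>\<gamma> (U p)\<close> by the fixed \<open>\<gamma> u\<close> at the price of the term
    with \<open>k\<close>.\<close>
  have estimate: "A (U p) (U p - w) + P (U p) (U p - w) / snd p
      \<le> f (U p - w) + \<Psi> w - \<Psi> (U p) + k * norm (U p - u) * norm (U p - w)"
    if "fst p > 0" "snd p > 0" "w \<in> Xh (fst p)" for p w
  proof -
    have neg: "\<xi> (w - U p) = - \<xi> (U p - w)" for \<xi> :: "'a \<Rightarrow>\<^sub>L real"
      by (simp add: blinfun.diff_right)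
    have "\<phi> (\<gamma> (U p)) (\<gamma> w) - \<phi> (\<gamma> (U p)) (\<gamma> (U p)) + \<Psi> (U p) - \<Psi> w
        \<le> \<alpha> * norm (\<gamma> (U p) - \<gamma> u) * norm (\<gamma> (U p) - \<gamma> w)"
      using A5_alpha(2)[of "\<gamma> (U p)" "\<gamma> w" "\<gamma> (U p)" "\<gamma> u"] by (simp add: \<Psi>_def)
    also have "\<dots> \<le> \<alpha> * (c * norm (U p - u)) * (c * norm (U p - w))"
      using A2 A5_alpha(1) by (intro mult_mono mult_left_mono) (auto simp flip: blinfun.diff_right)
    also have "\<dots> = k * norm (U p - u) * norm (U p - w)"
      by (simp add: k_def power2_eq_square)
    finally show ?thesis
      using uh(2)[OF that] unfolding U_def[symmetric] neg by simp
  qed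

  obtain vh where vh: "\<And>h. h > 0 \<Longrightarrow> vh h \<in> Xh h \<inter> K" "((\<lambda>h. norm (vh h - u)) \<longlongrightarrow> 0) (at_right 0)"
    using A9_approx_K[OF u(1)] by blast
  define V where "V p = vh (fst p)" for p :: "real \<times> real"
  have V_lim: "(V \<longlongrightarrow> u) F"
    unfolding V_def by (rule F_approx) (rule vh(2))
  have \<Psi>_V: "((\<lambda>p. \<Psi> (V p)) \<longlongrightarrow> \<Psi> u) F"
    by (rule isCont_tendsto_compose[OF \<Psi>_cont V_lim])
  have V_estimate: "A (U p) (U p - V p)
      \<le> f (U p - V p) + \<Psi> (V p) - \<Psi> (U p) + k * norm (U p - u) * norm (U p - V p)"
    if "fst p > 0" "snd p > 0" for p
  proof -
    have "V p \<in> Xh (fst p)" "V p \<in> K"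
      using vh(1)[OF that(1)] by (auto simp: V_def)
    then have "P (U p) (U p - V p) \<ge> 0"
      using P_mono[of "V p" "U p"] P_zero[of "V p"] by simp
    then have "P (U p) (U p - V p) / snd p \<ge> 0"
      using that by simp
    with estimate[OF that \<open>V p \<in> Xh (fst p)\<close>] show ?thesis by linarith
  qed

  \<comment> \<open>Boundedness of the discrete solutions\<close>
  have A_bounded: "bounded_operator A" and P_bounded: "bounded_operator P"
    using A4_pseudomonotone P by (auto simp: pseudomonotone_def penalty_operator_def)

  obtain R where R: "\<forall>\<^sub>F p in F. norm (U p) \<le> R"
  proof -
    obtain C where C: "C \<ge> 0" "\<And>x. norm x \<le> norm u + 1 \<Longrightarrow> norm (A x) \<le> C"
      using bounded_operatorD[OF A_bounded, of "norm u + 1"] by blast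
    \<comment> \<open>Coefficients of the quadratic inequality for
      \<open>s = norm (U p - V p)\<close> derived below: \<open>?a\<close> collects the terms linear
      in \<open>s\<close>, \<open>?b\<close> the constant ones.\<close>
    let ?a = "norm f + C + norm \<zeta> + k" and ?b = "1 + norm \<zeta>"
    have near: "\<forall>\<^sub>F p in F. dist (V p) u < 1"
      using V_lim by (rule tendstoD) simp
    have near': "\<forall>\<^sub>F p in F. \<Psi> (V p) < \<Psi> u + 1"
      using \<Psi>_V by (rule order_tendstoD) simp
    have "\<forall>\<^sub>F p in F. norm (U p) \<le> norm u + 2 + (?a + ?b) / (m - k)"
      using F_pos near near'
    proof eventually_elim
      case (elim p)
      define s where "s = norm (U p - V p)"
      have Vu: "norm (V p - u) \<le> 1" using elim by (simp add: dist_norm)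
      have Us: "norm (U p - u) \<le> s + 1"
        using norm_triangle_ineq[of "U p - V p" "V p - u"] Vu by (simp add: s_def)
      have Vn: "norm (V p) \<le> norm u + 1"
        using norm_triangle_sub[of "V p" u] Vu by simp
      have "norm (f - A (V p)) \<le> norm f + C"
        using norm_triangle_ineq4[of f "A (V p)"] C(2)[OF Vn] by linarith
      then have fA: "f (U p - V p) - A (V p) (U p - V p) \<le> (norm f + C) * s"
        using blinfun_abs_le[of "f - A (V p)" _ "U p - V p" s] by (force simp: s_def blinfun.diff_left)
      have "m * s\<^sup>2 \<le> A (U p) (U p - V p) - A (V p) (U p - V p)"
        using A4_strongly_monotone(2)[of "U p" "V p"] by (simp add: s_def blinfun.diff_left)
      also have "\<dots> \<le> (norm f + C) * s + (\<Psi> (V p) - \<Psi> (U p)) + k * norm (U p - u) * s"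
        using V_estimate[of p] elim fA by (simp add: s_def)
      also have "\<dots> \<le> (norm f + C) * s + (1 + norm \<zeta> * (s + 1)) + k * (s + 1) * s"
      proof -
        have "norm \<zeta> * norm (U p - u) \<le> norm \<zeta> * (s + 1)"
          using Us by (intro mult_left_mono) auto
        moreover have "k * norm (U p - u) * s \<le> k * (s + 1) * s"
          using Us k by (intro mult_right_mono mult_left_mono) (auto simp: s_def)
        ultimately show ?thesis
          using \<Psi>_lower[of "U p"] elim by linarith
      qed
      finally have "(m - k) * s\<^sup>2 \<le> ?a * s + ?b"
        by (simp add: algebra_simps power2_eq_square)
      then have "s \<le> 1 + (?a + ?b) / (m - k)"
        using k C(1) by (intro quadratic_le_linear_bound) (auto simp: s_def)
      then show ?case
        using norm_triangle_sub[of "U p" u] Us by linarith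
    qed
    then show ?thesis by (rule that)
  qed

  \<comment> \<open>Vanishing of the penalty in the limit\<close>
  obtain CA where CA: "CA \<ge> 0" "\<And>x. norm x \<le> R \<Longrightarrow> norm (A x) \<le> CA"
    using bounded_operatorD[OF A_bounded] by blast
  obtain CP where CP: "CP \<ge> 0" "\<And>x. norm x \<le> R \<Longrightarrow> norm (P x) \<le> CP"
    using bounded_operatorD[OF P_bounded] by blast
  have Uu: "norm (U p - u) \<le> R + norm u" if "norm (U p) \<le> R" for p
    using norm_triangle_ineq4[of "U p" u] that by linarith

  \<comment> \<open>Multiplying \<open>estimate\<close> by \<open>\<epsilon>\<close> leaves a small
    bound on the penalty term. Monotonicity then exchanges \<open>P (U p)\<close> for the fixed
    functional \<open>P w\<close>, so that the inequality survives weak limits.\<close>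
  have penalty_vanishes: "\<exists>r. (r \<longlongrightarrow> 0) F \<and> (\<forall>\<^sub>F p in F. P w (U p - w) \<le> r p)" for w
  proof -
    obtain wh where wh: "\<And>h. h > 0 \<Longrightarrow> wh h \<in> Xh h" "((\<lambda>h. norm (wh h - w)) \<longlongrightarrow> 0) (at_right 0)"
      using A9_approx[of w] by blast
    define W where "W p = wh (fst p)" for p :: "real \<times> real"
    have W_lim: "(W \<longlongrightarrow> w) F"
      unfolding W_def by (rule F_approx) (rule wh(2))
    let ?d = "R + norm w + 1"
    define D where "D = (norm f + CA) * ?d + (\<Psi> w + 1 - \<Psi> u + norm \<zeta> * (R + norm u))
      + k * (R + norm u) * ?d"
    have "((\<lambda>p. D * snd p + CP * norm (W p - w)) \<longlongrightarrow> D * 0 + CP * norm (w - w)) F"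
      by (intro tendsto_intros W_lim F_snd)
    moreover have "\<forall>\<^sub>F p in F. dist (W p) w < 1"
      using W_lim by (rule tendstoD) simp
    moreover have "\<forall>\<^sub>F p in F. \<Psi> (W p) < \<Psi> w + 1"
      using isCont_tendsto_compose[OF \<Psi>_cont W_lim] by (rule order_tendstoD) simp
    with F_pos R \<open>\<forall>\<^sub>F p in F. dist (W p) w < 1\<close>
    have "\<forall>\<^sub>F p in F. P w (U p - w) \<le> D * snd p + CP * norm (W p - w)"
    proof eventually_elim
      case (elim p)
      have Wn: "norm (W p) \<le> norm w + 1"
        using norm_triangle_sub[of "W p" w] elim by (simp add: dist_norm)
      have UW: "norm (U p - W p) \<le> ?d"
        using norm_triangle_ineq4[of "U p" "W p"] Wn elim by linarith
      have "norm (f - A (U p)) \<le> norm f + CA"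
        using norm_triangle_ineq4[of f "A (U p)"] CA(2)[of "U p"] elim by linarith
      then have fA: "f (U p - W p) - A (U p) (U p - W p) \<le> (norm f + CA) * ?d"
        using blinfun_abs_le[OF _ UW, of "f - A (U p)"] by (force simp: blinfun.diff_left)
      have \<zeta>R: "norm \<zeta> * norm (U p - u) \<le> norm \<zeta> * (R + norm u)"
        using Uu elim by (intro mult_left_mono) auto
      have kR: "k * norm (U p - u) * norm (U p - W p) \<le> k * (R + norm u) * ?d"
        using Uu[of p] UW k elim order_trans[OF norm_ge_zero[of "U p - u"]]
        by (intro mult_mono mult_left_mono mult_nonneg_nonneg) auto
      have "P (U p) (U p - W p) / snd p \<le> D"
        using estimate[of p "W p"] wh(1)[of "fst p"] elim fA \<zeta>R kR \<Psi>_lower[of "U p"]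
        by (simp add: D_def W_def)
      then have "P (U p) (U p - W p) \<le> D * snd p"
        using elim by (simp add: field_simps)
      moreover have "P (U p) (W p - w) \<le> CP * norm (W p - w)"
        using blinfun_abs_le[of "P (U p)" CP "W p - w" "norm (W p - w)"] CP(2) elim by force
      moreover have "P (U p) (U p - w) = P (U p) (U p - W p) + P (U p) (W p - w)"
        by (simp flip: blinfun.add_right)
      ultimately show ?case
        using P_mono[of w "U p"] by linarith
    qed
    ultimately show ?thesis by auto
  qed

  \<comment> \<open>Strong convergence\<close>
  have "(U \<longlongrightarrow> u) F"
  proof (rule ccontr)
    assume "\<not> (U \<longlongrightarrow> u) F"
    then obtain \<eta> where \<eta>: "\<eta> > 0" "\<exists>\<^sub>F p in F. \<eta> \<le> norm (U p - u)"
      unfolding tendsto_iff by (auto simp: not_eventually not_less dist_norm)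
    \<comment> \<open>Restricting to parameters with error at least \<open>\<eta>\<close> before
      taking a weak limit keeps this lower bound along every finer filter.\<close>
    define F' where "F' = inf F (principal {p. \<eta> \<le> norm (U p - u)})"
    have "F' \<noteq> bot"
      using \<eta>(2) by (auto simp: F'_def trivial_limit_def eventually_inf_principal frequently_def)
    moreover have "F' \<le> F" by (simp add: F'_def)
    ultimately obtain G l where G: "G \<le> F'" "G \<noteq> bot"
      and weak: "\<And>\<xi> :: 'a \<Rightarrow>\<^sub>L real. ((\<lambda>p. \<xi> (U p)) \<longlongrightarrow> \<xi> l) G"
      using reflexive_space_weak_cluster_point[OF A1_reflexive, of F' U R] R filter_leD by metis
    have "G \<le> F" using G(1) \<open>F' \<le> F\<close> by (rule order_trans)
    note [simp] = G(2)
    have weak_diff: "((\<lambda>p. \<xi> (U p - w)) \<longlongrightarrow> \<xi> (l - w)) G" for \<xi> :: "'a \<Rightarrow>\<^sub>L real" and w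
      using tendsto_diff[OF weak tendsto_const] by (simp add: blinfun.diff_right)

    have "P w (l - w) \<le> 0" for w
    proof -
      obtain r where "(r \<longlongrightarrow> 0) F" "\<forall>\<^sub>F p in F. P w (U p - w) \<le> r p"
        using penalty_vanishes by blast
      then have "(r \<longlongrightarrow> 0) G" "\<forall>\<^sub>F p in G. P w (U p - w) \<le> r p"
        using \<open>G \<le> F\<close> by (auto intro: tendsto_mono filter_leD)
      then show ?thesis
        by (intro tendsto_le[OF G(2) _ weak_diff])
    qed
    then have "P l = 0"
      using P by (intro demicontinuous_Minty_zero) (auto simp: penalty_operator_def)
    then have "l \<in> K" by (simp add: P_zero)

    \<comment> \<open>By the variational inequality \<open>u\<close> minimizes \<open>g\<close> on
      \<open>K\<close>. The subgradient at \<open>l\<close> then bounds \<open>g u - g (U p)\<close>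
      by a term that tends to zero weakly.\<close>
    define g where "g v = (A u - f) v + \<Psi> v" for v
    have "convex_on UNIV (blinfun_apply (A u - f))"
      by (auto simp: convex_on_def blinfun.add_right blinfun.scaleR_right)
    then have "convex_on UNIV g"
      unfolding g_def using \<Psi>_convex by (intro convex_on_add)
    moreover have "isCont g l"
      unfolding g_def by (intro continuous_intros \<Psi>_cont)
    ultimately obtain \<omega> :: "'a \<Rightarrow>\<^sub>L real" where \<omega>: "\<And>v. g l + \<omega> (v - l) \<le> g v"
      using convex_on_subgradient by metis
    have "g u \<le> g l"
      using u(2)[OF \<open>l \<in> K\<close>] by (simp add: g_def \<Psi>_def blinfun.diff_left blinfun.diff_right)

    \<comment> \<open>The first term tends to zero by weak convergence, the others because
      \<open>V p\<close> tends to \<open>u\<close>.\<close>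
    define E where "E p = - \<omega> (U p - l) + (\<Psi> (V p) - \<Psi> u)
      + (CA + norm f + k * (R + norm u)) * norm (V p - u)" for p
    have "(E \<longlongrightarrow> - \<omega> (l - l) + (\<Psi> u - \<Psi> u)
      + (CA + norm f + k * (R + norm u)) * norm (u - u)) G"
      unfolding E_def using \<open>G \<le> F\<close>
      by (intro tendsto_add tendsto_minus tendsto_diff tendsto_mult tendsto_norm tendsto_const weak_diff
          tendsto_mono[OF _ \<Psi>_V] tendsto_mono[OF _ V_lim])
    then have E_lim: "(E \<longlongrightarrow> 0) G" by (simp add: blinfun.zero_right)
    have "\<forall>\<^sub>F p in G. norm (U p) \<le> R" "\<forall>\<^sub>F p in G. fst p > 0 \<and> snd p > 0"
      using R F_pos \<open>G \<le> F\<close> by (auto intro: filter_leD)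
    moreover have "\<forall>\<^sub>F p in G. \<eta> \<le> norm (U p - u)"
      using G(1) by (rule filter_leD) (simp add: F'_def eventually_inf_principal)
    ultimately have "\<forall>\<^sub>F p in G. (m - k) * \<eta>\<^sup>2 \<le> E p"
    proof eventually_elim
      case (elim p)
      define s where "s = norm (U p - u)"
      define d where "d = norm (V p - u)"
      have UV: "norm (U p - V p) \<le> s + d"
        using norm_triangle_ineq4[of "U p - u" "V p - u"] by (simp add: s_def d_def)
      have "k * s * norm (U p - V p) \<le> k * s * (s + d)"
        using UV k by (intro mult_left_mono) (auto simp: s_def)
      \<comment> \<open>Only the factor \<open>s\<close> of the cross term \<open>k * s * d\<close>
        is bounded by a constant; \<open>k * s\<^sup>2\<close> is kept, to be absorbed since
        \<open>k < m\<close>.\<close>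
      also have "\<dots> \<le> k * s\<^sup>2 + k * (R + norm u) * d"
        using Uu[of p] k elim mult_right_mono[of s "R + norm u" "k * d"]
        by (simp add: s_def d_def algebra_simps power2_eq_square)
      finally have 1: "k * s * norm (U p - V p) \<le> k * s\<^sup>2 + k * (R + norm u) * d" .
      have 2: "A (U p) (V p - u) \<le> CA * d"
        using blinfun_abs_le[of "A (U p)" CA "V p - u" d] CA(2) elim by (force simp: d_def)
      have 3: "- f (V p - u) \<le> norm f * d"
        using blinfun_abs_le[of f "norm f" "V p - u" d] by (force simp: d_def)
      have 4: "g u - g (U p) \<le> - \<omega> (U p - l)"
        using \<omega>[of "U p"] \<open>g u \<le> g l\<close> by linarith
      have "m * s\<^sup>2 \<le> A (U p) (U p - u) - A u (U p - u)"
        using A4_strongly_monotone(2)[of "U p" u] by (simp add: s_def blinfun.diff_left)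
      then have "m * s\<^sup>2 \<le> A (U p) (U p - V p) + A (U p) (V p - u) - A u (U p - u)"
        by (simp add: blinfun.diff_right)
      moreover have "f (U p - V p) = f (U p - u) - f (V p - u)"
        by (simp add: blinfun.diff_right)
      moreover have "g u - g (U p) = f (U p - u) - A u (U p - u) + (\<Psi> u - \<Psi> (U p))"
        by (simp add: g_def blinfun.diff_right blinfun.diff_left)
      ultimately have "m * s\<^sup>2 \<le> k * s\<^sup>2 + E p"
        using V_estimate[of p] elim 1 2 3 4 unfolding E_def s_def[symmetric] d_def[symmetric]
        by (simp add: algebra_simps)
      moreover have "(m - k) * \<eta>\<^sup>2 \<le> (m - k) * s\<^sup>2"
        using elim \<eta>(1) k by (intro mult_left_mono power_mono) (auto simp: s_def)
      ultimately show ?case by (simp add: algebra_simps)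
    qed
    then have "(m - k) * \<eta>\<^sup>2 \<le> 0"
      using E_lim by (intro tendsto_lowerbound[OF E_lim]) auto
    moreover have "(m - k) * \<eta>\<^sup>2 > 0"
      using \<eta>(1) k by simp
    ultimately show False by simp
  qed
  show ?thesis
  proof (intro allI impI)
    fix \<eta> :: real assume "\<eta> > 0"
    with \<open>(U \<longlongrightarrow> u) F\<close> have "\<forall>\<^sub>F p in F. norm (U p - u) < \<eta>"
      by (auto simp: tendsto_iff dist_norm)
    \<comment> \<open>A product filter splits the condition into one on \<open>h\<close> and one on
      \<open>\<epsilon>\<close>, whence the separate thresholds.\<close>
    then obtain Q1 Q2 where Q: "\<forall>\<^sub>F h in at_right 0. Q1 h" "\<forall>\<^sub>F \<epsilon> in at_right 0. Q2 \<epsilon>"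
      "\<And>h \<epsilon>. Q1 h \<Longrightarrow> Q2 \<epsilon> \<Longrightarrow> norm (uh h \<epsilon> - u) < \<eta>"
      unfolding F_def eventually_prod_filter U_def by auto
    then obtain h0 \<epsilon>0 where pos: "h0 > 0" "\<epsilon>0 > 0"
      and small: "\<And>h. 0 < h \<Longrightarrow> h < h0 \<Longrightarrow> Q1 h" "\<And>\<epsilon>. 0 < \<epsilon> \<Longrightarrow> \<epsilon> < \<epsilon>0 \<Longrightarrow> Q2 \<epsilon>"
      unfolding eventually_at_right_field by metis
    have "\<forall>h \<epsilon>. 0 < h \<and> h < h0 \<and> 0 < \<epsilon> \<and> \<epsilon> < \<epsilon>0 \<longrightarrow> norm (uh h \<epsilon> - u) < \<eta>"
      using Q(3) small by simp
    with pos show "\<exists>h0>0. \<exists>\<epsilon>0>0. \<forall>h \<epsilon>. 0 < h \<and> h < h0 \<and> 0 < \<epsilon> \<and> \<epsilon> < \<epsilon>0 \<longrightarrow>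
        norm (uh h \<epsilon> - u) < \<eta>"
      by (intro exI[of _ h0] exI[of _ \<epsilon>0] conjI)
  qed
qed

end
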